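(* For $n\in\mathbb{N}$ and a word $w=a_1\cdots a_{2n}\in \mathrm{Cat}_n$, we have $$D(w)=\prod_{i=1}^{2n}\left[\overline{a}_1+\cdots+\overline{a}_{i-1}+(\overline{a}_i+1)/2\right]_q.$$ Moreover, $D(w)=E(w)^2$, where $$E(w)=\prod_{\substack{1\le i\le 2n\\ a_i=x}}[\overline{a}_1+\cdots+\overline{a}_i]_q=\prod_{\substack{1\le i\le 2n\\ a_i=y}}[\overline{a}_1+\cdots+\overline{a}_{i-1}]_q$$ (in particular the last two products are equal).
   Context: Conventions: $\mathbb{N}=\{0,1,2,\ldots\}$; $\mathbb{F}$ is a field; $q\in\mathbb{F}$ is nonzero and not a root of unity; $[n]_q=\frac{q^n-q^{-n}}{q-q^{-1}}$. Empty products are $1$. $q$-shuffle algebra: Let $x,y$ be noncommuting indeterminates (letters) and let $\mathbb{V}$ be the free (unital associative) $\mathbb{F}$-algebra generated by $x,y$; its product is concatenation, and the words in $x,y$ form a basis of $\mathbb{V}$; the empty (trivial) word is denoted $\mathbf{1}$. Put $\langle x,x\rangle=\langle y,y\rangle=2$, $\langle x,y\rangle=\langle y,x\rangle=-2$. The $q$-shuffle product $\star$ is the bilinear associative product on $\mathbb{V}$ determined by $\mathbf{1}\star v=v\star\mathbf{1}=v$ and, for nontrivial words $u=u_1\cdots u_r$, $v=v_1\cdots v_s$, $$u\star v=u_1\big((u_2\cdots u_r)\star v\big)+v_1\big(u\star(v_2\cdots v_s)\big)q^{\langle v_1,u_1\rangle+\cdots+\langle v_1,u_r\rangle}.$$ Elements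 $D_n$: Let $\tilde G_0=\mathbf{1}$ and $\tilde G_{n+1}=\tilde G_n xy$ (concatenation), so $\tilde G_n=xyxy\cdots xy$ ($n$ copies of $xy$). Define $D_0=\mathbf{1}$ and $D_n=-\sum_{k=0}^{n-1}D_k\star\tilde G_{n-k}$ for $n\ge 1$. Catalan words: Put $\overline{x}=1$, $\overline{y}=-1$. A word $a_1\cdots a_k$ is Catalan if $\overline{a}_1+\cdots+\overline{a}_i\ge 0$ for $1\le i\le k-1$ and $\overline{a}_1+\cdots+\overline{a}_k=0$. $\mathrm{Cat}_n$ is the set of Catalan words of length $2n$ (so $\mathrm{Cat}_0=\{\mathbf{1}\}$). For $n\in\mathbb{N}$, $D_n$ lies in the span of $\mathrm{Cat}_n$. For $w\in\mathrm{Cat}_n$, the scalar $D(w)$ is defined by: $(-1)^nD(w)$ is the coefficient of $w$ in $D_n$, i.e. $D_n=(-1)^n\sum_{w\in\mathrm{Cat}_n}D(w)w$. *)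

theory Defs
  imports "HOL-Library.Poly_Mapping"
begin

datatype letter = Lx | Ly

text \<open>
  Lists form a monoid under concatenation.  With this instance, the product of
  \<open>HOL-Library.Poly_Mapping\<close> on finitely supported functions on words is the linear extension of
  concatenation, so that type, with \<open>*\<close> and \<open>1\<close>, is the free unital associative algebra on the
  letters.
\<close>

instantiation list :: (type) monoid_add
begin

definition zero_list_def: "(0 :: 'a list) = []"

definition plus_list_def: "(u :: 'a list) + v = u @ v"

instance by standard (simp_all add: zero_list_def plus_list_def)

end

type_synonym 'a free_alg = "letter list \<Rightarrow>\<^sub>0 'a"

abbreviation of_word :: "letter list \<Rightarrow> 'a::field free_alg" where
  "of_word w \<equiv> Poly_Mapping.single w 1"

definition scale :: "'a::field \<Rightarrow> 'a free_alg \<Rightarrow> 'a free_alg" where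
  "scale c f = Poly_Mapping.map ((*) c) f"

definition form :: "letter \<Rightarrow> letter \<Rightarrow> int" where
  "form a b = (if a = b then 2 else -2)"

fun qshuffle_words :: "'a::field \<Rightarrow> letter list \<Rightarrow> letter list \<Rightarrow> 'a free_alg" where
  "qshuffle_words q [] v = of_word v"
| "qshuffle_words q u [] = of_word u"
| "qshuffle_words q (a # u) (b # v) =
     of_word [a] * qshuffle_words q u (b # v)
     + scale (q powi (\<Sum>c\<leftarrow>a # u. form b c)) (of_word [b] * qshuffle_words q (a # u) v)"

definition qshuffle :: "'a::field \<Rightarrow> 'a free_alg \<Rightarrow> 'a free_alg \<Rightarrow> 'a free_alg" where
  "qshuffle q f g =
     (\<Sum>u\<in>Poly_Mapping.keys f. \<Sum>v\<in>Poly_Mapping.keys g.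
        scale (Poly_Mapping.lookup f u * Poly_Mapping.lookup g v) (qshuffle_words q u v))"

primrec Gtilde :: "nat \<Rightarrow> 'a::field free_alg" where
  "Gtilde 0 = 1"
| "Gtilde (Suc n) = Gtilde n * of_word [Lx] * of_word [Ly]"

fun Delt :: "'a::field \<Rightarrow> nat \<Rightarrow> 'a free_alg" where
  "Delt q 0 = 1"
| "Delt q (Suc n) = - (\<Sum>k\<le>n. qshuffle q (Delt q k) (Gtilde (Suc n - k)))"

fun wt :: "letter \<Rightarrow> int" where
  "wt Lx = 1"
| "wt Ly = -1"

text \<open>Words \<open>a\<^sub>1 \<dots> a\<^sub>k\<close> are indexed from 1, whereas \<open>!\<close> counts from 0.\<close>

definition height :: "letter list \<Rightarrow> nat \<Rightarrow> int" where
  "height w i = (\<Sum>j=1..i. wt (w ! (j - 1)))"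

definition catalan :: "letter list \<Rightarrow> bool" where
  "catalan w \<longleftrightarrow>
     (\<forall>i. 1 \<le> i \<and> i \<le> length w - 1 \<longrightarrow> 0 \<le> height w i) \<and> height w (length w) = 0"

definition Cat :: "nat \<Rightarrow> letter list set" where
  "Cat n = {w. catalan w \<and> length w = 2 * n}"

definition qint :: "'a::field \<Rightarrow> int \<Rightarrow> 'a" where
  "qint q m = (q powi m - q powi (- m)) / (q - inverse q)"

definition Dcoeff :: "'a::field \<Rightarrow> letter list \<Rightarrow> 'a" where
  "Dcoeff q w = (-1) ^ (length w div 2) * Poly_Mapping.lookup (Delt q (length w div 2)) w"

definition Eprod :: "'a::field \<Rightarrow> letter list \<Rightarrow> 'a" where
  "Eprod q w = (\<Prod>i | 1 \<le> i \<and> i \<le> length w \<and> w ! (i - 1) = Lx. qint q (height w i))"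

lemma lookup_scale [simp]: "Poly_Mapping.lookup (scale c f) w = c * Poly_Mapping.lookup f w"
  unfolding scale_def by (simp add: map.rep_eq when_def)

lemma scale_one [simp]: "scale 1 f = f"
  by (rule poly_mapping_eqI) simp

lemma qshuffle_of_word: "qshuffle q (of_word u) (of_word v) = qshuffle_words q u v"
  by (simp add: qshuffle_def)

lemma of_word_mult: "(of_word u * of_word v :: 'a::field free_alg) = of_word (u @ v)"
  by (simp add: mult_single plus_list_def)

lemma of_word_Nil: "of_word [] = (1 :: 'a::field free_alg)"
  by (simp flip: single_one add: zero_list_def)

text \<open>The property by which the scalars \<open>D(w)\<close> are introduced.\<close>

lemma Dcoeff_lookup:
  assumes "w \<in> Cat n"
  shows "(-1) ^ n * Dcoeff q w = Poly_Mapping.lookup (Delt q n) w"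
  using assms by (simp add: Cat_def Dcoeff_def flip: mult.assoc power_mult_distrib)

end

theory Submission
  imports Defs
begin

text \<open>
  The recursion defining \<open>D\<^sub>n\<close> says that \<open>\<Sum>\<^sub>k D\<^sub>k \<star> G\<^sub>n\<^sub>-\<^sub>k = 0\<close> for \<open>n \<ge> 1\<close>, where
  \<open>G\<^sub>m = xyxy\<dots>xy\<close>, and this determines the \<open>D\<^sub>n\<close>.  So it suffices to check that the elements with
  the claimed coefficients satisfy it.

  Read a word as a lattice path, \<open>x\<close> going up and \<open>y\<close> going down.  The claimed coefficient, sign
  included, is a product over the steps: \<open>-[h+1]\<close> for a step up from height \<open>h\<close> and \<open>[h]\<close> for a step
  down from height \<open>h\<close>.  Since \<open>[0] = 0\<close>, paths from \<open>0\<close> to \<open>0\<close> that dip below \<open>0\<close>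
  get coefficient \<open>0\<close>, and the sums can run over all paths from \<open>0\<close> to \<open>0\<close>.

  Fix a word \<open>w\<close> and write \<open>C\<^sub>h(w)\<close> (\<open>signed_conv q h w\<close>) for the coefficient of \<open>w\<close> in the sum, over
  all paths \<open>u\<close> from height \<open>h\<close> to \<open>0\<close>, of the step product of \<open>u\<close> times \<open>u \<star> v\<close>, where \<open>v\<close> is the
  alternating word ending in \<open>y\<close> whose length makes up the difference to \<open>w\<close>.  The case \<open>h = 0\<close> is
  the coefficient in the convolution above.  The \<open>q\<close>-shuffle product is defined by taking the first
  letter from one of the two factors, and the power of \<open>q\<close> that this costs depends on \<open>u\<close> only through
  \<open>h\<close>.  Hence \<open>C\<^sub>h\<close> obeys a recursion on \<open>w\<close> (\<open>signed_conv_Cons\<close>): if \<open>p\<close> has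
  the parity of the length of the word on the left, then
    \<^item> \<open>C\<^sub>p(xw') = -[p+1] C\<^sub>p\<^sub>+\<^sub>1(w') + q\<^sup>-\<^sup>2\<^sup>p C\<^sub>p(w')\<close> and \<open>C\<^sub>p\<^sub>-\<^sub>1(xw') = -[p] C\<^sub>p(w')\<close>,
    \<^item> \<open>C\<^sub>p(yw') = [p] C\<^sub>p\<^sub>-\<^sub>1(w')\<close> and
      \<open>C\<^sub>p\<^sub>-\<^sub>1(yw') = [p-1] C\<^sub>p\<^sub>-\<^sub>2(w') + q\<^sup>2\<^sup>(\<^sup>p\<^sup>-\<^sup>1\<^sup>) C\<^sub>p\<^sub>-\<^sub>1(w')\<close>.

  On such words \<open>C\<^sub>p\<^sub>-\<^sub>1 = q\<^sup>p\<^sup>-\<^sup>1 C\<^sub>p\<close> for \<open>p \<ge> 1\<close> (\<open>signed_conv_shift\<close>), by induction on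
  \<open>w\<close> and the two rules expressing \<open>[p+1]\<close> through \<open>[p]\<close>.  For \<open>p = 1\<close> this makes the two terms of
  \<open>C\<^sub>0(xw')\<close> cancel, while \<open>C\<^sub>0(yw')\<close> has the factor \<open>[0]\<close>; so \<open>C\<^sub>0\<close> vanishes on nonempty words of
  even length (\<open>signed_conv_eq_0\<close>), which is the required identity.

  The formula for \<open>D(w)\<close> then splits into the factors of the up steps and those of the down steps.
  On a Catalan word these two products agree, because every up step to a height \<open>j\<close> is matched by a
  down step from height \<open>j\<close> (\<open>path_prod_down_eq_up\<close>); their common value is \<open>E(w)\<close>.
\<close>

section \<open>Coefficients of \<open>q\<close>-shuffle products of words\<close>

instance letter :: finite
proof
  have "(UNIV :: letter set) = {Lx, Ly}" using letter.exhaust by auto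
  then show "finite (UNIV :: letter set)" by (metis finite.emptyI finite_insert)
qed

abbreviation weight :: "letter list \<Rightarrow> int" where
  "weight u \<equiv> \<Sum>c\<leftarrow>u. wt c"

lemma finite_words_length_le: "finite {u :: letter list. length u \<le> m \<and> P u}"
  using finite_lists_length_le[of "UNIV :: letter set" m] by (rule rev_finite_subset) auto

lemma finite_words_length_eq: "finite {u :: letter list. length u = m \<and> P u}"
  using finite_words_length_le[of m] by (rule rev_finite_subset) auto

text \<open>When a word \<open>u\<close> is shuffled with an alternating word \<open>v\<close> to give words of a given length, this
  lets the weight of \<open>u\<close> alone decide the parity of \<open>length v\<close>, and hence the first letter of \<open>v\<close>.\<close>

lemma even_weight_iff: "even (weight u) \<longleftrightarrow> even (length u)"
proof (induction u)
  case (Cons a u)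
  then show ?case by (cases a) auto
qed simp

lemma sum_form: "(\<Sum>c\<leftarrow>u. form b c) = 2 * wt b * weight u"
proof (induction u)
  case (Cons a u)
  then show ?case by (cases a; cases b) (auto simp: form_def algebra_simps)
qed simp

lemma lookup_letter_mult:
  "Poly_Mapping.lookup (of_word [a] * f :: 'a::field free_alg) w =
     (\<Sum>u\<in>Poly_Mapping.keys f. if a # u = w then Poly_Mapping.lookup f u else 0)"
proof -
  have "f = (\<Sum>u\<in>Poly_Mapping.keys f. Poly_Mapping.single u (Poly_Mapping.lookup f u))"
    by (rule poly_mapping_eqI) (simp add: lookup_sum lookup_single when_def in_keys_iff)
  then have "of_word [a] * f =
      (\<Sum>u\<in>Poly_Mapping.keys f. of_word [a] * Poly_Mapping.single u (Poly_Mapping.lookup f u))"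
    by (metis sum_distrib_left)
  then show ?thesis
    by (simp add: mult_single plus_list_def lookup_sum lookup_single when_def)
qed

lemma lookup_letter_mult_Nil:
  "Poly_Mapping.lookup (of_word [a] * f :: 'a::field free_alg) [] = 0"
  by (simp add: lookup_letter_mult)

lemma lookup_letter_mult_Cons:
  "Poly_Mapping.lookup (of_word [a] * f :: 'a::field free_alg) (c # w) =
     (if a = c then Poly_Mapping.lookup f w else 0)"
  by (simp add: lookup_letter_mult in_keys_iff)

lemma qshuffle_words_Nil_right [simp]: "qshuffle_words q u [] = of_word u"
  by (cases u) simp_all

text \<open>With guards in place of the case distinction on empty factors, one rule covers all cases: when
  one factor is empty, the other is read off letter by letter.\<close>

lemma lookup_qshuffle_words_Cons:
  "Poly_Mapping.lookup (qshuffle_words q u v) (c # w) =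
     (if u \<noteq> [] \<and> hd u = c then Poly_Mapping.lookup (qshuffle_words q (tl u) v) w else 0)
     + (if v \<noteq> [] \<and> hd v = c
        then q powi (2 * wt c * weight u) * Poly_Mapping.lookup (qshuffle_words q u (tl v)) w
        else 0)"
  by (cases u; cases v)
     (auto simp: lookup_add lookup_letter_mult_Cons lookup_single when_def sum_form
           simp del: sum_list.Cons list.map(2))

lemma lookup_qshuffle_words_length:
  assumes "length w \<noteq> length u + length v"
  shows "Poly_Mapping.lookup (qshuffle_words q u v) w = 0"
  using assms
proof (induction w arbitrary: u v)
  case Nil
  then show ?case
    by (cases u; cases v) (auto simp: lookup_add lookup_letter_mult_Nil lookup_single when_def)
next
  case (Cons c w)
  have "u \<noteq> [] \<Longrightarrow> Poly_Mapping.lookup (qshuffle_words q (tl u) v) w = 0"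
    using Cons.prems by (intro Cons.IH) (cases u; simp)
  moreover have "v \<noteq> [] \<Longrightarrow> Poly_Mapping.lookup (qshuffle_words q u (tl v)) w = 0"
    using Cons.prems by (intro Cons.IH) (cases v; simp)
  ultimately show ?case by (auto simp: lookup_qshuffle_words_Cons simp del: qshuffle_words_Nil_right)
qed

lemma lookup_qshuffle_of_word:
  assumes "finite U" "\<And>u. u \<notin> U \<Longrightarrow> Poly_Mapping.lookup f u = 0"
  shows "Poly_Mapping.lookup (qshuffle q f (of_word v)) w =
    (\<Sum>u\<in>U. Poly_Mapping.lookup f u * Poly_Mapping.lookup (qshuffle_words q u v) w)"
proof -
  have "Poly_Mapping.lookup (qshuffle q f (of_word v)) w =
    (\<Sum>u\<in>Poly_Mapping.keys f. Poly_Mapping.lookup f u * Poly_Mapping.lookup (qshuffle_words q u v) w)"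
    by (simp add: qshuffle_def lookup_sum)
  also have "\<dots> = (\<Sum>u\<in>U. Poly_Mapping.lookup f u * Poly_Mapping.lookup (qshuffle_words q u v) w)"
    using assms by (intro sum.mono_neutral_left) (auto simp: in_keys_iff)
  finally show ?thesis .
qed

text \<open>Tails of \<open>xyxy\<dots>xy\<close> occur in the recursion, so the words are built from their last letter
  \<open>y\<close>; the parity of the length then determines the first letter.\<close>

primrec alt_word :: "nat \<Rightarrow> letter list" where
  "alt_word 0 = []"
| "alt_word (Suc n) = (if even n then Ly else Lx) # alt_word n"

lemma length_alt_word [simp]: "length (alt_word n) = n"
  by (induction n) auto

lemma alt_word_append: "alt_word (2 * n) @ [Lx, Ly] = alt_word (2 * Suc n)"
  by (induction n) (simp_all add: numeral_2_eq_2 del: One_nat_def, simp_all flip: numeral_2_eq_2)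

lemma Gtilde_eq_alt_word: "Gtilde n = of_word (alt_word (2 * n))"
proof (induction n)
  case 0
  then show ?case by (simp add: of_word_Nil)
next
  case (Suc n)
  then have "Gtilde (Suc n) = (of_word (alt_word (2 * n) @ [Lx, Ly]) :: 'a free_alg)"
    by (simp add: of_word_mult)
  then show ?case by (simp only: alt_word_append)
qed

section \<open>Products along lattice paths\<close>

text \<open>The argument \<open>h\<close> is the height at which the path starts, and \<open>f\<close> weighs a step by the height from
  which it departs.\<close>

primrec path_prod :: "(int \<Rightarrow> letter \<Rightarrow> 'a::comm_monoid_mult) \<Rightarrow> int \<Rightarrow> letter list \<Rightarrow> 'a" where
  "path_prod f h [] = 1"
| "path_prod f h (a # w) = f h a * path_prod f (h + wt a) w"

lemma height_0 [simp]: "height w 0 = 0"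
  by (simp add: height_def)

lemma height_Suc: "height w (Suc i) = height w i + wt (w ! i)"
  by (simp add: height_def)

lemma height_Cons_Suc: "height (a # w) (Suc i) = wt a + height w i"
  by (induction i) (simp_all add: height_Suc)

lemma path_prod_eq_prod: "path_prod f h w = (\<Prod>i<length w. f (h + height w i) (w ! i))"
proof (induction w arbitrary: h)
  case (Cons a w)
  show ?case
    by (simp add: Cons prod.lessThan_Suc_shift height_Cons_Suc add.assoc del: prod.lessThan_Suc)
qed simp

lemma path_prod_mult: "path_prod (\<lambda>h a. f h a * g h a) h w = path_prod f h w * path_prod g h w"
  by (simp add: path_prod_eq_prod prod.distrib)

text \<open>Attaching the sign \<open>(-1)\<^sup>n\<close> of \<open>D\<^sub>n\<close> to the up steps, of which a path of length \<open>2n\<close> from \<open>0\<close> to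
  \<open>0\<close> has \<open>n\<close>, makes the coefficient multiplicative along the path.\<close>

definition signed_step :: "'a::field \<Rightarrow> int \<Rightarrow> letter \<Rightarrow> 'a" where
  "signed_step q h a = (if a = Lx then - qint q (h + 1) else qint q h)"

definition up_step :: "'a::field \<Rightarrow> int \<Rightarrow> letter \<Rightarrow> 'a" where
  "up_step q h a = (if a = Lx then qint q (h + 1) else 1)"

definition down_step :: "'a::field \<Rightarrow> int \<Rightarrow> letter \<Rightarrow> 'a" where
  "down_step q h a = (if a = Ly then qint q h else 1)"

lemma path_prod_signed_step:
  "path_prod (signed_step q) h w =
     (-1) ^ count_list w Lx * (path_prod (up_step q) h w * path_prod (down_step q) h w)"
proof (induction w arbitrary: h)
  case (Cons a w)
  then show ?case by (cases a) (auto simp: signed_step_def up_step_def down_step_def)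
qed simp

lemma two_count_Lx: "2 * int (count_list w Lx) = int (length w) + weight w"
proof (induction w)
  case (Cons a w)
  then show ?case by (cases a) auto
qed simp

text \<open>A path from height \<open>h\<close> to \<open>0\<close> that stays nonnegative steps down from each \<open>j \<ge> 1\<close> as often as it
  steps up to \<open>j\<close>, and once more if \<open>j \<le> h\<close>; the surplus is the \<open>q\<close>-factorial of \<open>h\<close>.  Only \<open>h = 0\<close> is
  of final interest, but the induction passes through all heights.\<close>

lemma path_prod_down_eq_up:
  assumes "\<And>i. i \<le> length w \<Longrightarrow> 0 \<le> int h + height w i"
    and "int h + height w (length w) = 0"
  shows "path_prod (down_step q) (int h) w =
    (\<Prod>j=1..h. qint q (int j)) * path_prod (up_step q) (int h) w"
  using assms
proof (induction w arbitrary: h)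
  case Nil
  then show ?case by simp
next
  case (Cons a w)
  have nonneg: "0 \<le> int h + wt a + height w i" if "i \<le> length w" for i
    using Cons.prems(1)[of "Suc i"] that by (simp add: height_Cons_Suc add.assoc)
  have final: "int h + wt a + height w (length w) = 0"
    using Cons.prems(2) by (simp add: height_Cons_Suc add.assoc)
  show ?case
  proof (cases a)
    case Lx
    then show ?thesis
      using Cons.IH[of "Suc h"] nonneg final
      by (simp add: up_step_def down_step_def add.commute mult_ac)
  next
    case Ly
    with nonneg[of 0] obtain k where "h = Suc k" by (cases h) auto
    then show ?thesis
      using Ly Cons.IH[of k] nonneg final
      by (simp add: up_step_def down_step_def add.commute mult_ac)
  qed
qed

section \<open>Cancellation in the convolution\<close>

text \<open>The second factor is determined by its length, which must be \<open>length w - length u\<close> for \<open>w\<close> to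
  occur.  So one sum over \<open>u\<close> replaces the double sum over \<open>k\<close> and the words in \<open>D\<^sub>k\<close>.\<close>

definition signed_conv :: "'a::field \<Rightarrow> int \<Rightarrow> letter list \<Rightarrow> 'a" where
  "signed_conv q h w =
     (\<Sum>u | length u \<le> length w \<and> weight u = - h.
        path_prod (signed_step q) h u
        * Poly_Mapping.lookup (qshuffle_words q u (alt_word (length w - length u))) w)"

lemma signed_conv_Nil: "signed_conv q h [] = (if h = 0 then 1 else 0)"
proof -
  have "{u. length u \<le> length ([] :: letter list) \<and> weight u = - h} = (if h = 0 then {[]} else {})"
    by auto
  then show ?thesis by (simp add: signed_conv_def)
qed

text \<open>The first letter \<open>c\<close> of \<open>w\<close> comes either from \<open>u\<close>, which moves the height, or from the alternating
  word, which does not.  In the second case \<open>c\<close> has to be the first letter of that word, and the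
  \<open>q\<close>-power is the same for all \<open>u\<close>, since they share the weight \<open>-h\<close>.\<close>

lemma signed_conv_Cons:
  "signed_conv q h (c # w) =
     signed_step q h c * signed_conv q (h + wt c) w
     + (if c = Ly \<longleftrightarrow> even (int (length w) + h)
        then q powi (- 2 * h * wt c) * signed_conv q h w else 0)"
proof -
  let ?S = "{u. length u \<le> length (c # w) \<and> weight u = - h}"
  let ?v = "\<lambda>u. alt_word (length (c # w) - length u)"
  let ?P = "\<lambda>u. path_prod (signed_step q) h u"
  \<comment> \<open>\<open>?A u\<close> and \<open>?B u\<close> are the contributions in which \<open>c\<close> is taken from \<open>u\<close> and from \<open>?v u\<close>.\<close>
  let ?A = "\<lambda>u. if u \<noteq> [] \<and> hd u = c
    then ?P u * Poly_Mapping.lookup (qshuffle_words q (tl u) (?v u)) w else 0"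
  let ?B = "\<lambda>u. if ?v u \<noteq> [] \<and> hd (?v u) = c
    then ?P u * (q powi (2 * wt c * weight u) * Poly_Mapping.lookup (qshuffle_words q u (tl (?v u))) w)
    else 0"
  have fin: "finite ?S" by (rule finite_words_length_le)
  have "signed_conv q h (c # w) = (\<Sum>u\<in>?S. ?A u + ?B u)"
    unfolding signed_conv_def
    by (intro sum.cong refl) (auto simp: lookup_qshuffle_words_Cons distrib_left)
  also have "\<dots> = sum ?A ?S + sum ?B ?S" by (rule sum.distrib)
  also have "sum ?A ?S = sum ?A ((#) c ` {u. length u \<le> length w \<and> weight u = - (h + wt c)})"
  proof (rule sum.mono_neutral_right[OF fin])
    show "(#) c ` {u. length u \<le> length w \<and> weight u = - (h + wt c)} \<subseteq> ?S" by auto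
    show "\<forall>u \<in> ?S - (#) c ` {u. length u \<le> length w \<and> weight u = - (h + wt c)}. ?A u = 0"
    proof
      fix u assume u: "u \<in> ?S - (#) c ` {u. length u \<le> length w \<and> weight u = - (h + wt c)}"
      show "?A u = 0"
      proof (cases u)
        case (Cons a u')
        have "a \<noteq> c" using u Cons by auto
        then show ?thesis using Cons by simp
      qed simp
    qed
  qed
  also have "\<dots> = signed_step q h c * signed_conv q (h + wt c) w"
    by (simp add: sum.reindex signed_conv_def sum_distrib_left mult.assoc)
  also have "sum ?B ?S = sum ?B {u. length u \<le> length w \<and> weight u = - h}"
    by (rule sum.mono_neutral_right[OF fin]) (auto simp: le_Suc_eq)
  also have "\<dots> = (\<Sum>u | length u \<le> length w \<and> weight u = - h.
      (if c = Ly \<longleftrightarrow> even (int (length w) + h) then q powi (- 2 * h * wt c) else 0) *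
      (?P u * Poly_Mapping.lookup (qshuffle_words q u (alt_word (length w - length u))) w))"
  proof (rule sum.cong[OF refl])
    fix u assume "u \<in> {u. length u \<le> length w \<and> weight u = - h}"
    then have len: "length u \<le> length w" and wu: "weight u = - h" by auto
    have v: "?v u = (if even (length w - length u) then Ly else Lx) # alt_word (length w - length u)"
      using len by (simp add: Suc_diff_le)
    have parity: "even (length w - length u) \<longleftrightarrow> even (int (length w) + h)"
      using len wu even_weight_iff[of u] by auto
    have "hd (?v u) = c \<longleftrightarrow> (c = Ly \<longleftrightarrow> even (int (length w) + h))"
      unfolding v parity by (cases c) auto
    moreover have exponent: "2 * wt c * - h = - 2 * h * wt c" by simp
    moreover have "?v u \<noteq> []" "tl (?v u) = alt_word (length w - length u)"
      unfolding v by simp_all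
    ultimately show "?B u = (if c = Ly \<longleftrightarrow> even (int (length w) + h) then q powi (- 2 * h * wt c) else 0) *
      (?P u * Poly_Mapping.lookup (qshuffle_words q u (alt_word (length w - length u))) w)"
      unfolding wu exponent
      by (cases "c = Ly \<longleftrightarrow> even (int (length w) + h)")
         (simp_all only: simp_thms if_True if_False mult_zero_left mult.left_commute not_False_eq_True)
  qed
  also have "\<dots> = (if c = Ly \<longleftrightarrow> even (int (length w) + h)
      then q powi (- 2 * h * wt c) * signed_conv q h w else 0)"
    by (cases "c = Ly \<longleftrightarrow> even (int (length w) + h)")
       (simp_all only: signed_conv_def sum_distrib_left simp_thms if_True if_False mult_zero_left
         sum.neutral_const not_False_eq_True)
  finally show ?thesis .
qed

lemma qint_0 [simp]: "qint q 0 = 0"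
  by (simp add: qint_def)

text \<open>The condition \<open>q\<^sup>2 \<noteq> 1\<close> keeps the denominator \<open>q - q\<^sup>-\<^sup>1\<close> away from \<open>0\<close>; otherwise \<open>qint\<close> would be
  identically \<open>0\<close>.\<close>

lemma qint_rec:
  fixes q :: "'a::field"
  assumes "q \<noteq> 0" "q\<^sup>2 \<noteq> 1"
  shows "qint q (p + 1) = q * qint q p + q powi (- p)"
    and "qint q (p + 1) = inverse q * qint q p + q powi p"
proof -
  have d: "q - inverse q \<noteq> 0"
  proof
    assume "q - inverse q = 0"
    then have "q * q = inverse q * q" by simp
    then show False using assms by (simp add: power2_eq_square)
  qed
  have frac: "(A * q - B * r) / (q - r) = q * ((A - B) / (q - r)) + B"
    "(A * q - B * r) / (q - r) = r * ((A - B) / (q - r)) + A"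
    if "q - r \<noteq> 0" for A B r :: 'a
    using that by (simp_all add: add_divide_eq_iff field_simps del: right_minus_eq)
  have e: "q powi (p + 1) = q powi p * q" "q powi (- (p + 1)) = q powi (- p) * inverse q"
    "q powi (- 1 - p) = q powi (- p) * inverse q"
    using assms(1) by (auto simp: power_int_add power_int_diff power_int_minus field_simps)
  show "qint q (p + 1) = q * qint q p + q powi (- p)"
    and "qint q (p + 1) = inverse q * qint q p + q powi p"
    unfolding qint_def e using frac[OF d] by blast+
qed

text \<open>For heights \<open>p\<close> and \<open>p - 1\<close>, the alternating word left to be shuffled in begins with \<open>x\<close> and with
  \<open>y\<close> respectively.  The two values are proportional with a factor independent of \<open>w\<close>: each of the
  rules \<open>[p+1] = q[p] + q\<^sup>-\<^sup>p\<close> and \<open>[p+1] = q\<^sup>-\<^sup>1[p] + q\<^sup>p\<close> is what one of the two letters requires.\<close>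

lemma signed_conv_shift:
  fixes q :: "'a::field"
  assumes q: "q \<noteq> 0" "q\<^sup>2 \<noteq> 1" and "p \<ge> 1" "even (int (length w) + p)"
  shows "signed_conv q (p - 1) w = q powi (p - 1) * signed_conv q p w"
  using assms(3,4)
proof (induction w arbitrary: p)
  case Nil
  then have "p \<noteq> 1" "p \<noteq> 0" by auto
  then show ?case by (simp add: signed_conv_Nil)
next
  case (Cons c w)
  have odd: "odd (int (length w) + p)" using Cons.prems by (simp add: add.commute)
  show ?case
  proof (cases c)
    case Lx
    have IH: "signed_conv q p w = q powi p * signed_conv q (p + 1) w"
      using Cons.IH[of "p + 1"] Cons.prems odd by (simp add: algebra_simps)
    have "signed_conv q (p - 1) (c # w) = - qint q p * signed_conv q p w"
      using Lx odd by (simp add: signed_conv_Cons signed_step_def)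
    also have "\<dots> = - (q powi (p - 1)) * (q * qint q p) * signed_conv q (p + 1) w"
      using q by (simp add: IH power_int_diff)
    also have "q * qint q p = qint q (p + 1) - q powi (- 2 * p) * q powi p"
      using qint_rec(1)[OF q, of p] q by (simp flip: power_int_add)
    also have "- (q powi (p - 1)) * (qint q (p + 1) - q powi (- 2 * p) * q powi p)
        * signed_conv q (p + 1) w
      = q powi (p - 1) * signed_conv q p (c # w)"
      using Lx odd by (simp add: signed_conv_Cons signed_step_def IH algebra_simps)
    finally show ?thesis .
  next
    case Ly
    have IH: "qint q (p - 1) * signed_conv q (p - 2) w
      = qint q (p - 1) * (q powi (p - 2) * signed_conv q (p - 1) w)"
      \<comment> \<open>At \<open>p = 1\<close> the induction hypothesis would concern a negative height; the factor \<open>[0]\<close> is zero.\<close>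
    proof (cases "p = 1")
      case False
      have "even (int (length w) + (p - 1))" using odd by presburger
      with False show ?thesis using Cons.IH[of "p - 1"] Cons.prems(1) by simp
    qed simp
    have "signed_conv q (p - 1) (c # w)
      = qint q (p - 1) * signed_conv q (p - 2) w + q powi (2 * (p - 1)) * signed_conv q (p - 1) w"
      using Ly odd by (simp add: signed_conv_Cons signed_step_def)
    also have "\<dots> = q powi (p - 1) * (inverse q * qint q (p - 1) + q powi (p - 1))
        * signed_conv q (p - 1) w"
    proof -
      have "q powi (p - 2) = q powi (p - 1) * inverse q"
        using q by (simp add: power_int_diff field_simps power2_eq_square)
      moreover have "q powi (2 * (p - 1)) = q powi (p - 1) * q powi (p - 1)"
        using q by (simp flip: power_int_add)
      ultimately show ?thesis unfolding IH by (simp add: algebra_simps)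
    qed
    also have "inverse q * qint q (p - 1) + q powi (p - 1) = qint q p"
      using qint_rec(2)[OF q, of "p - 1"] by simp
    also have "q powi (p - 1) * qint q p * signed_conv q (p - 1) w
      = q powi (p - 1) * signed_conv q p (c # w)"
      using Ly odd by (simp add: signed_conv_Cons signed_step_def)
    finally show ?thesis .
  qed
qed

lemma signed_conv_eq_0:
  fixes q :: "'a::field"
  assumes q: "q \<noteq> 0" "q\<^sup>2 \<noteq> 1" and "w \<noteq> []" "even (length w)"
  shows "signed_conv q 0 w = 0"
proof (cases w)
  case (Cons c w')
  have odd: "odd (length w')" using assms Cons by simp
  show ?thesis
  proof (cases c)
    case Lx
    have "signed_conv q 0 w' = signed_conv q 1 w'"
      using signed_conv_shift[OF q, of 1 w'] odd by simp
    moreover have "qint q 1 = 1" using qint_rec(1)[OF q, of 0] by simp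
    ultimately show ?thesis using Lx Cons odd by (simp add: signed_conv_Cons signed_step_def)
  next
    case Ly
    then show ?thesis using Cons odd by (simp add: signed_conv_Cons signed_step_def)
  qed
qed (use assms in simp)

section \<open>The coefficients of \<open>D\<^sub>n\<close>\<close>

text \<open>At height \<open>0\<close> the sum over \<open>u\<close> is the convolution of the coefficients of \<open>D\<^sub>k\<close> with \<open>xyxy\<dots>xy\<close>.  Its
  last term, where \<open>v\<close> is empty, only sees \<open>u = w\<close> and is the coefficient to be determined.\<close>

lemma signed_conv_0_split:
  fixes q :: "'a::field"
  assumes "length w = 2 * Suc n"
  shows "signed_conv q 0 w =
    (\<Sum>k\<le>n. \<Sum>u | length u = 2 * k \<and> weight u = 0. path_prod (signed_step q) 0 u
        * Poly_Mapping.lookup (qshuffle_words q u (alt_word (2 * (Suc n - k)))) w)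
    + (if weight w = 0 then path_prod (signed_step q) 0 w else 0)"
proof -
  let ?g = "\<lambda>u. path_prod (signed_step q) 0 u
        * Poly_Mapping.lookup (qshuffle_words q u (alt_word (length w - length u))) w"
  let ?U = "\<lambda>k. {u :: letter list. length u = 2 * k \<and> weight u = 0}"
  have U: "{u. length u \<le> length w \<and> weight u = - 0} = (\<Union>k\<in>{..Suc n}. ?U k)"
  proof (intro equalityI subsetI)
    fix u assume "u \<in> {u. length u \<le> length w \<and> weight u = - 0}"
    then have "length u \<le> 2 * Suc n" "weight u = 0" "even (length u)"
      using assms even_weight_iff[of u] by auto
    then show "u \<in> (\<Union>k\<in>{..Suc n}. ?U k)" by (auto elim!: evenE)
  qed (use assms in auto)
  have "signed_conv q 0 w = (\<Sum>k\<le>Suc n. sum ?g (?U k))"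
    unfolding signed_conv_def U
    by (rule sum.UNION_disjoint) (auto intro: finite_words_length_eq)
  also have "\<dots> = (\<Sum>k\<le>n. sum ?g (?U k)) + sum ?g (?U (Suc n))" by simp
  also have "(\<Sum>k\<le>n. sum ?g (?U k)) =
    (\<Sum>k\<le>n. \<Sum>u\<in>?U k. path_prod (signed_step q) 0 u
        * Poly_Mapping.lookup (qshuffle_words q u (alt_word (2 * (Suc n - k)))) w)"
    using assms by (intro sum.cong refl) (auto simp: diff_mult_distrib2)
  also have "sum ?g (?U (Suc n)) = (\<Sum>u\<in>?U (Suc n). if u = w then path_prod (signed_step q) 0 w else 0)"
    using assms by (intro sum.cong refl) (auto simp: lookup_single when_def)
  also have "\<dots> = (if weight w = 0 then path_prod (signed_step q) 0 w else 0)"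
    using assms by (subst sum.delta[OF finite_words_length_eq]) auto
  finally show ?thesis .
qed

text \<open>The last term of the convolution is minus the sum of the others, because the total is zero; the
  recursion for \<open>D\<^sub>n\<close> says the same.\<close>

lemma lookup_Delt:
  fixes q :: "'a::field"
  assumes q: "q \<noteq> 0" "q\<^sup>2 \<noteq> 1"
  shows "Poly_Mapping.lookup (Delt q n) w =
    (if length w = 2 * n \<and> weight w = 0 then path_prod (signed_step q) 0 w else 0)"
proof (induction n arbitrary: w rule: less_induct)
  case (less n)
  show ?case
  proof (cases n)
    case 0
    then show ?thesis by (auto simp: lookup_single when_def simp flip: of_word_Nil)
  next
    case (Suc m)
    let ?U = "\<lambda>k. {u :: letter list. length u = 2 * k \<and> weight u = 0}"
    have summand: "Poly_Mapping.lookup (qshuffle q (Delt q k) (Gtilde (Suc m - k))) w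
      = (\<Sum>u\<in>?U k. path_prod (signed_step q) 0 u
          * Poly_Mapping.lookup (qshuffle_words q u (alt_word (2 * (Suc m - k)))) w)"
      if "k \<le> m" for k
    proof -
      have IH: "Poly_Mapping.lookup (Delt q k) u
        = (if u \<in> ?U k then path_prod (signed_step q) 0 u else 0)" for u
        using less[of k u] that Suc by simp
      show ?thesis
        unfolding Gtilde_eq_alt_word
        by (subst lookup_qshuffle_of_word[of "?U k"])
           (auto simp only: IH finite_words_length_eq intro!: sum.cong split: if_splits)
    qed
    have D: "Poly_Mapping.lookup (Delt q n) w = - (\<Sum>k\<le>m. \<Sum>u\<in>?U k. path_prod (signed_step q) 0 u
          * Poly_Mapping.lookup (qshuffle_words q u (alt_word (2 * (Suc m - k)))) w)"
      using summand by (simp add: Suc lookup_sum)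
    show ?thesis
    proof (cases "length w = 2 * n")
      case True
      then have "signed_conv q 0 w = 0"
        using Suc by (intro signed_conv_eq_0[OF q]) auto
      then show ?thesis
        using signed_conv_0_split[of w m q] True Suc D by (simp add: add_eq_0_iff)
    next
      case False
      then have "Poly_Mapping.lookup (qshuffle_words q u (alt_word (2 * (Suc m - k)))) w = 0"
        if "k \<le> m" "u \<in> ?U k" for k u
        using that Suc by (intro lookup_qshuffle_words_length) auto
      then show ?thesis using False D by simp
    qed
  qed
qed

section \<open>The product formulas\<close>

lemma weight_eq_height: "weight w = height w (length w)"
  by (induction w) (simp_all add: height_Cons_Suc)

theorem theorem1p11:
  fixes q :: "'a::field" and n :: nat and w :: "letter list"
  assumes "q \<noteq> 0"
    and "\<forall>k::nat. k \<ge> 1 \<longrightarrow> q ^ k \<noteq> 1"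
    and "w \<in> Cat n"
  shows "Dcoeff q w = (\<Prod>i=1..2*n. qint q (height w (i - 1) + (wt (w ! (i - 1)) + 1) div 2))
    \<and> Dcoeff q w = (Eprod q w)\<^sup>2
    \<and> Eprod q w = (\<Prod>i | 1 \<le> i \<and> i \<le> 2*n \<and> w ! (i - 1) = Lx. qint q (height w i))
    \<and> Eprod q w = (\<Prod>i | 1 \<le> i \<and> i \<le> 2*n \<and> w ! (i - 1) = Ly. qint q (height w (i - 1)))"
proof -
  have q2: "q\<^sup>2 \<noteq> 1" using assms(2) by simp
  have len: "length w = 2 * n" and cat: "catalan w"
    using assms(3) by (auto simp: Cat_def)
  have h0: "height w (length w) = 0" using cat by (simp add: catalan_def)
  have nonneg: "0 \<le> height w i" if "i \<le> length w" for i
  proof -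
    have "i = 0 \<or> i = length w \<or> 1 \<le> i \<and> i \<le> length w - 1" using that by linarith
    then show ?thesis using cat h0 by (auto simp: catalan_def)
  qed
  have shift: "(\<Prod>i=1..2*n. g i) = (\<Prod>i<length w. g (Suc i))" for g :: "nat \<Rightarrow> 'a"
    unfolding len by (rule prod.reindex_bij_witness[of _ Suc "\<lambda>i. i - 1"]) auto
  have restrict: "(\<Prod>i | 1 \<le> i \<and> i \<le> 2*n \<and> w ! (i - 1) = b. g i)
      = (\<Prod>i<length w. if w ! i = b then g (Suc i) else 1)" for g :: "nat \<Rightarrow> 'a" and b
  proof -
    have "(\<Prod>i | 1 \<le> i \<and> i \<le> 2*n \<and> w ! (i - 1) = b. g i)
      = (\<Prod>i \<in> {i \<in> {1..2*n}. w ! (i - 1) = b}. g i)"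
      by (rule prod.cong) auto
    also have "\<dots> = (\<Prod>i=1..2*n. if w ! (i - 1) = b then g i else 1)"
      by (rule prod.inter_filter) simp
    finally show ?thesis by (simp only: shift diff_Suc_1)
  qed
  have up: "path_prod (up_step q) 0 w
      = (\<Prod>i | 1 \<le> i \<and> i \<le> 2*n \<and> w ! (i - 1) = Lx. qint q (height w i))"
    unfolding restrict path_prod_eq_prod
    by (intro prod.cong refl) (auto simp: up_step_def height_Suc)
  have down: "path_prod (down_step q) 0 w
      = (\<Prod>i | 1 \<le> i \<and> i \<le> 2*n \<and> w ! (i - 1) = Ly. qint q (height w (i - 1)))"
    unfolding restrict path_prod_eq_prod
    by (intro prod.cong refl) (auto simp: down_step_def)
  have E: "Eprod q w = path_prod (up_step q) 0 w"
    unfolding Eprod_def up len ..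
  have down_up: "path_prod (down_step q) 0 w = path_prod (up_step q) 0 w"
    using path_prod_down_eq_up[of w 0 q] nonneg h0 by simp
  have "count_list w Lx = n"
    using two_count_Lx[of w] h0 len by (simp add: weight_eq_height)
  then have D: "Dcoeff q w = path_prod (up_step q) 0 w * path_prod (down_step q) 0 w"
    using len h0 by (simp add: Dcoeff_def lookup_Delt[OF assms(1) q2] weight_eq_height
        path_prod_signed_step flip: mult.assoc power_mult_distrib)
  have "(\<Prod>i=1..2*n. qint q (height w (i - 1) + (wt (w ! (i - 1)) + 1) div 2))
      = path_prod (\<lambda>h a. up_step q h a * down_step q h a) 0 w"
    unfolding shift path_prod_eq_prod
  proof (rule prod.cong[OF refl])
    fix i
    show "qint q (height w (Suc i - 1) + (wt (w ! (Suc i - 1)) + 1) div 2)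
      = up_step q (0 + height w i) (w ! i) * down_step q (0 + height w i) (w ! i)"
      by (cases "w ! i") (simp_all add: up_step_def down_step_def)
  qed
  then show ?thesis
    using D E down_up up down by (simp add: path_prod_mult power2_eq_square)
qed

end
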